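(* Let $\delta\in\mathbb{C}$ and let $N$ be a nontrivial (i.e. with nonzero multiplication) $2$-dimensional $\delta$-Novikov algebra over $\mathbb{C}$. Then $N$ is isomorphic to one of the following algebras with basis $e_1,e_2$, taken among those whose listed condition on $\delta$ is satisfied (products of basis elements not listed are zero; "any $\delta$" means the algebra is $\delta$-Novikov for every $\delta\in\mathbb{C}$). Moreover, each listed algebra is $\delta$-Novikov under its listed condition on $\delta$. \begin{itemize} \item $\mathbf{N}_{01}$ ($\delta=1$): $e_1e_1=e_1+e_2$, $e_2e_1=e_2$. \item $\mathbf{N}_{02}$ (any $\delta$): $e_1e_1=e_2$. \item $\mathbf{N}_{03}$ ($\delta=0$): $e_1e_2=e_1$. \item $\mathbf{N}_{04}$ (any $\delta$): $e_2e_1=e_1$. \item $\mathbf{N}_{05}$ ($\delta=0$): $e_1e_1=e_1$, $e_1e_2=e_1$. \item $\mathbf{N}_{06}$ ($\delta=0$): $e_1e_1=e_1$, $e_2e_1=e_1$. \item $\mathbf{N}_{07}$ (any $\delta$): $e_1e_1=e_1$. \item $\mathbf{N}_{08}^{\delta}$ (any $\delta\neq 0$): $e_1e_1=e_1$, $e_2e_1=\delta^{-1}e_2$. \item $\mathbf{N}_{09}$ (any $\delta$): $e_1e_1=e_1$, $e_1e_2=e_2$, $e_2e_1=e_2$. \item $\mathbf{N}_{10}^{\alpha}$, $\alpha\in\mathbb{C}$, $\alpha\neq 1$ ($\delta=1$): $e_1e_1=e_1$, $e_1e_2=\alpha e_2$, $e_2e_1=e_2$. \item $\mathbf{N}_{11}$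 (any $\delta$): $e_1e_1=e_1$, $e_2e_2=e_2$. \item $\mathbf{N}_{12}$ ($\delta=-1$): $e_1e_1=e_1$, $e_1e_2=-e_1$, $e_2e_1=-e_2$, $e_2e_2=e_2$. \end{itemize}
   Context: Algebras are not necessarily associative, over $\mathbb{C}$. For a fixed $\delta\in\mathbb{C}$, a (left) $\delta$-Novikov algebra is an algebra $N$ satisfying, for all $x,y,z\in N$, $\delta(xy)z-x(yz)=\delta(yx)z-y(xz)$ and $(xy)z=(xz)y$. *)

theory Defs
  imports "HOL-Analysis.Analysis"
begin

locale complex_algebra = vector_space scale
  for scale :: "complex \<Rightarrow> 'a::ab_group_add \<Rightarrow> 'a" +
  fixes mult :: "'a \<Rightarrow> 'a \<Rightarrow> 'a"
  assumes linear_mult_right: "Vector_Spaces.linear scale scale (\<lambda>y. mult x y)"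
    and linear_mult_left: "Vector_Spaces.linear scale scale (\<lambda>x. mult x y)"

locale novikov_algebra = complex_algebra scale mult
  for scale :: "complex \<Rightarrow> 'a::ab_group_add \<Rightarrow> 'a"
    and mult :: "'a \<Rightarrow> 'a \<Rightarrow> 'a" +
  fixes \<delta> :: complex
  assumes delta_left_symmetric:
      "scale \<delta> (mult (mult x y) z) - mult x (mult y z)
        = scale \<delta> (mult (mult y x) z) - mult y (mult x z)"
    and right_commutative: "mult (mult x y) z = mult (mult x z) y"

definition algebra_isomorphic ::
  "(complex \<Rightarrow> 'a::ab_group_add \<Rightarrow> 'a) \<Rightarrow> ('a \<Rightarrow> 'a \<Rightarrow> 'a) \<Rightarrow>
   (complex \<Rightarrow> 'b::ab_group_add \<Rightarrow> 'b) \<Rightarrow> ('b \<Rightarrow> 'b \<Rightarrow> 'b) \<Rightarrow> bool"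
  where "algebra_isomorphic s1 m1 s2 m2 \<longleftrightarrow>
    (\<exists>f. Vector_Spaces.linear s1 s2 f \<and> bij f \<and> (\<forall>x y. f (m1 x y) = m2 (f x) (f y)))"

abbreviation e1 :: "complex ^ 2" where "e1 \<equiv> axis 1 1"
abbreviation e2 :: "complex ^ 2" where "e2 \<equiv> axis 2 1"

text \<open>Bilinear extension of a multiplication table; the arguments are, in this order,
  the products \<open>e1 e1\<close>, \<open>e1 e2\<close>, \<open>e2 e1\<close>, \<open>e2 e2\<close>.\<close>

definition table_mult ::
  "complex ^ 2 \<Rightarrow> complex ^ 2 \<Rightarrow> complex ^ 2 \<Rightarrow> complex ^ 2 \<Rightarrow>
   complex ^ 2 \<Rightarrow> complex ^ 2 \<Rightarrow> complex ^ 2"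
  where "table_mult p11 p12 p21 p22 x y =
    (x $ 1 * y $ 1) *s p11 + (x $ 1 * y $ 2) *s p12 +
    (x $ 2 * y $ 1) *s p21 + (x $ 2 * y $ 2) *s p22"

definition "N01 = table_mult (e1 + e2) 0 e2 0"
definition "N02 = table_mult e2 0 0 0"
definition "N03 = table_mult 0 e1 0 0"
definition "N04 = table_mult 0 0 e1 0"
definition "N05 = table_mult e1 e1 0 0"
definition "N06 = table_mult e1 0 e1 0"
definition "N07 = table_mult e1 0 0 0"
definition "N08 \<delta> = table_mult e1 0 (inverse \<delta> *s e2) 0"
definition "N09 = table_mult e1 e2 e2 0"
definition "N10 \<alpha> = table_mult e1 (\<alpha> *s e2) e2 0"
definition "N11 = table_mult e1 0 0 e2"
definition "N12 = table_mult e1 (- e1) (- e2) e2"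

inductive listed :: "complex \<Rightarrow> (complex ^ 2 \<Rightarrow> complex ^ 2 \<Rightarrow> complex ^ 2) \<Rightarrow> bool"
  where
    "\<delta> = 1 \<Longrightarrow> listed \<delta> N01"
  | "listed \<delta> N02"
  | "\<delta> = 0 \<Longrightarrow> listed \<delta> N03"
  | "listed \<delta> N04"
  | "\<delta> = 0 \<Longrightarrow> listed \<delta> N05"
  | "\<delta> = 0 \<Longrightarrow> listed \<delta> N06"
  | "listed \<delta> N07"
  | "\<delta> \<noteq> 0 \<Longrightarrow> listed \<delta> (N08 \<delta>)"
  | "listed \<delta> N09"
  | "\<delta> = 1 \<Longrightarrow> \<alpha> \<noteq> 1 \<Longrightarrow> listed \<delta> (N10 \<alpha>)"
  | "listed \<delta> N11"
  | "\<delta> = -1 \<Longrightarrow> listed \<delta> N12"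

end

theory Submission
  imports Defs
begin

text \<open>
  Right commutativity says that the right multiplications \<open>x \<mapsto> xy\<close> commute with one another. In
  dimension two a commuting family of operators over an algebraically closed field has one of two
  shapes: either it is diagonal in some basis \<open>u, v\<close>, or in some basis every member is
  \<open>a I + b N\<close> with the fixed nilpotent \<open>N u = v\<close>, \<open>N v = 0\<close>. This is
  \<open>right_multiplications_normal_form\<close>. Either shape leaves only four structure constants.

  In such a basis the other identity, \<open>\<delta> [x, y] z = x (y z) - y (x z)\<close>, is skew in \<open>x, y\<close>, so that only
  \<open>x = u\<close>, \<open>y = v\<close> matters; comparing coefficients for \<open>z = u\<close> and \<open>z = v\<close> gives a few polynomial
  equations between \<open>\<delta>\<close> and the structure constants (\<open>diagonal_structure_equations\<close>,
  \<open>jordan_structure_equations\<close>). They factor, and on each branch an explicit change of basis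
  produces one of the tables. The diagonal family leads to \<open>N03\<close>, \<open>N05\<close>, \<open>N07\<close>, \<open>N08\<close>, \<open>N11\<close>, \<open>N12\<close>,
  and the family with a nonzero nilpotent part to \<open>N01\<close>, \<open>N02\<close>, \<open>N04\<close>, \<open>N09\<close>, \<open>N10\<close>. The algebra
  \<open>N06\<close> does not appear as a separate outcome because it is isomorphic to \<open>N05\<close>, via
  \<open>e1 \<mapsto> e1\<close>, \<open>e2 \<mapsto> e1 - e2\<close>.

  The converse, that each table satisfies both identities, is a calculation in coordinates.
\<close>

section \<open>Bases of a plane\<close>

locale vector_plane = vector_space +
  assumes dim_UNIV: "dim (UNIV :: 'b set) = 2"
begin

definition indep_pair :: "'b \<Rightarrow> 'b \<Rightarrow> bool"
  where "indep_pair u v \<longleftrightarrow> (\<forall>a b. scale a u + scale b v = 0 \<longrightarrow> a = 0 \<and> b = 0)"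

lemma indep_pairD:
  "indep_pair u v \<Longrightarrow> scale a u + scale b v = 0 \<Longrightarrow> a = 0"
  "indep_pair u v \<Longrightarrow> scale a u + scale b v = 0 \<Longrightarrow> b = 0"
  by (auto simp: indep_pair_def)

lemma indep_pair_combination_eq_iff:
  assumes "indep_pair u v"
  shows "scale a u + scale b v = scale c u + scale d v \<longleftrightarrow> a = c \<and> b = d"
proof
  assume "scale a u + scale b v = scale c u + scale d v"
  then have "scale (a - c) u + scale (b - d) v = 0"
    by (simp add: algebra_simps)
  with assms have "a - c = 0" "b - d = 0"
    by (blast dest: indep_pairD)+
  then show "a = c \<and> b = d" by simp
qed simp

lemma indep_pair_swap: "indep_pair u v \<Longrightarrow> indep_pair v u"
  by (metis add.commute indep_pair_def)

lemma indep_pair_change_of_basis: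
  assumes "indep_pair u v" and det: "p * s - q * r \<noteq> 0"
  shows "indep_pair (scale p u + scale q v) (scale r u + scale s v)"
  unfolding indep_pair_def
proof (intro allI impI)
  fix a b
  assume "scale a (scale p u + scale q v) + scale b (scale r u + scale s v) = 0"
  then have "scale (a * p + b * r) u + scale (a * q + b * s) v = 0"
    by (simp add: algebra_simps)
  with assms(1) have eqs: "a * p + b * r = 0" "a * q + b * s = 0"
    by (blast dest: indep_pairD)+
  have "a * (p * s - q * r) = (a * p + b * r) * s - (a * q + b * s) * r"
    "b * (p * s - q * r) = (a * q + b * s) * p - (a * p + b * r) * q"
    by (simp_all add: algebra_simps)
  then have "a * (p * s - q * r) = 0" "b * (p * s - q * r) = 0"
    by (simp_all only: eqs) simp_all
  with det show "a = 0 \<and> b = 0" by simp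
qed

lemma independent_pair_iff:
  assumes "u \<noteq> v"
  shows "independent {u, v} \<longleftrightarrow> indep_pair u v"
proof
  assume "independent {u, v}"
  then have *: "f u = 0 \<and> f v = 0" if "scale (f u) u + scale (f v) v = 0" for f
    using that assms by (auto simp: dependent_finite)
  show "indep_pair u v"
    unfolding indep_pair_def
  proof (intro allI impI)
    fix a b
    assume "scale a u + scale b v = 0"
    then show "a = 0 \<and> b = 0"
      using *[of "\<lambda>w. if w = u then a else b"] assms by auto
  qed
next
  assume "indep_pair u v"
  then show "independent {u, v}"
    using assms by (auto simp: dependent_finite dest: indep_pairD)
qed

lemma indep_pair_imp_neq:
  assumes "indep_pair u v"
  shows "u \<noteq> v"
proof
  assume "u = v"
  then have "scale 1 u + scale (- 1) v = 0" by simp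
  with assms have "(1::'a) = 0" by (rule indep_pairD)
  then show False by simp
qed

lemma obtain_indep_pair:
  obtains u v where "indep_pair u v"
proof -
  obtain B :: "'b set" where "independent B" "card B = 2"
    using basis_exists[of "UNIV :: 'b set"] dim_UNIV by auto
  then obtain u v where "u \<noteq> v" "B = {u, v}"
    by (auto simp: card_2_iff)
  with \<open>independent B\<close> show thesis
    by (simp add: independent_pair_iff that)
qed

lemma indep_pair_spans:
  assumes "indep_pair u v"
  obtains a b where "x = scale a u + scale b v"
proof -
  obtain B :: "'b set" where B: "independent B" "UNIV \<subseteq> span B" "card B = 2"
    using basis_exists[of "UNIV :: 'b set"] dim_UNIV by auto
  then have "finite B" by (metis card.infinite zero_neq_numeral)
  interpret finite_dimensional_vector_space scale B
    by unfold_locales (use B \<open>finite B\<close> in auto)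
  have "independent {u, v}" "card {u, v} = 2"
    using assms indep_pair_imp_neq[OF assms] by (auto simp: independent_pair_iff)
  then have "UNIV \<subseteq> span {u, v}"
    using dim_UNIV B(3) by (intro card_ge_dim_independent) auto
  then obtain a b where "x - scale a u = scale b v"
    by (force simp: span_breakdown_eq span_singleton)
  then have "x = scale a u + scale b v" by (simp add: algebra_simps)
  then show thesis by (rule that)
qed

end

section \<open>Algebras presented by a multiplication table\<close>

context complex_algebra
begin

lemma mult_add_right: "mult x (y + z) = mult x y + mult x z"
  and mult_scale_right: "mult x (scale c y) = scale c (mult x y)"
  using linear_mult_right[of x] by (simp_all add: Vector_Spaces.linear_iff)

lemma mult_add_left: "mult (x + y) z = mult x z + mult y z"
  and mult_scale_left: "mult (scale c x) z = scale c (mult x z)"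
  using linear_mult_left[of z] by (simp_all add: Vector_Spaces.linear_iff)

lemma mult_diff_right: "mult x (y - z) = mult x y - mult x z"
  using mult_add_right[of x "y - z" z] by (simp add: eq_diff_eq)

lemma mult_diff_left: "mult (x - y) z = mult x z - mult y z"
  using mult_add_left[of "x - y" y z] by (simp add: eq_diff_eq)

lemma mult_minus_right: "mult x (- y) = - mult x y"
  using mult_scale_right[of x "- 1" y] by simp

lemma mult_minus_left: "mult (- x) y = - mult x y"
  using mult_scale_left[of "- 1" x y] by simp

lemmas mult_bilinear =
  mult_add_right mult_diff_right mult_minus_right mult_scale_right
  mult_add_left mult_diff_left mult_minus_left mult_scale_left

end

locale plane_algebra = complex_algebra scale mult + vector_plane scale
  for scale :: "complex \<Rightarrow> 'a::ab_group_add \<Rightarrow> 'a" and mult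
begin

abbreviation isomorphic_to :: "(complex ^ 2 \<Rightarrow> complex ^ 2 \<Rightarrow> complex ^ 2) \<Rightarrow> bool"
  where "isomorphic_to M \<equiv> algebra_isomorphic scale mult ((*s) :: complex \<Rightarrow> complex ^ 2 \<Rightarrow> complex ^ 2) M"

text \<open>To recognise a table it suffices to find two independent vectors that multiply like \<open>e1, e2\<close>.\<close>

lemma isomorphic_to_table_mult:
  assumes uv: "indep_pair u v"
    and uu: "mult u u = scale (p11 $ 1) u + scale (p11 $ 2) v"
    and uv': "mult u v = scale (p12 $ 1) u + scale (p12 $ 2) v"
    and vu: "mult v u = scale (p21 $ 1) u + scale (p21 $ 2) v"
    and vv: "mult v v = scale (p22 $ 1) u + scale (p22 $ 2) v"
  shows "isomorphic_to (table_mult p11 p12 p21 p22)"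
proof -
  define f where "f x = scale (x $ 1) u + scale (x $ 2) v" for x :: "complex ^ 2"
  have f_add: "f (x + y) = f x + f y" and f_scale: "f (c *s x) = scale c (f x)" for x y c
    by (simp_all add: f_def algebra_simps)
  have f_mult: "f (table_mult p11 p12 p21 p22 x y) = mult (f x) (f y)" for x y
    by (simp add: f_def table_mult_def mult_bilinear uu uv' vu vv algebra_simps)
  have "inj f"
    by (rule injI) (simp add: f_def indep_pair_combination_eq_iff[OF uv] vec_eq_iff forall_2)
  moreover have "surj f"
  proof (rule surjI)
    fix x
    obtain a b where "x = scale a u + scale b v"
      using indep_pair_spans[OF uv] .
    then have "f (vector [a, b]) = x" by (simp add: f_def)
    then show "f (SOME y. f y = x) = x" by (rule someI)
  qed
  ultimately have "bij f" by (rule bijI)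
  then have inv_f: "f (inv f x) = x" "inv f x = y \<longleftrightarrow> x = f y" for x y
    by (auto simp: bij_is_surj surj_f_inv_f bij_is_inj inv_f_f)
  have "Vector_Spaces.linear scale (*s) (inv f)"
    unfolding Vector_Spaces.linear_iff inv_f(2)
    by (auto simp: f_add f_scale inv_f(1) vec.vector_space_axioms vector_space_axioms)
  moreover have "inv f (mult x y) = table_mult p11 p12 p21 p22 (inv f x) (inv f y)" for x y
    by (simp add: inv_f f_mult)
  ultimately show ?thesis
    unfolding algebra_isomorphic_def using bij_imp_bij_inv[OF \<open>bij f\<close>] by blast
qed

end

section \<open>Normal forms of commuting right multiplications\<close>

locale plane_novikov_algebra = plane_algebra scale mult + novikov_algebra scale mult \<delta>
  for scale :: "complex \<Rightarrow> 'a::ab_group_add \<Rightarrow> 'a" and mult \<delta>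
begin

text \<open>
  Write \<open>R_a\<close> for the right multiplication by \<open>a\<close>. If some \<open>T = R_a\<close> has a cyclic vector
  \<open>u\<close>, then an operator commuting with \<open>T\<close> is determined by its value at \<open>u\<close>, hence is a polynomial in
  \<open>T\<close>; a basis that puts \<open>T\<close> in Jordan form therefore serves all \<open>R_y\<close> at once. If no \<open>R_a\<close> has a
  cyclic vector, every vector is an eigenvector of every \<open>R_a\<close>, and any basis is diagonal.
\<close>

lemma right_multiplications_normal_form:
  obtains
    (diagonal) u v f g where "indep_pair u v"
      "\<And>y. mult u y = scale (f y) u" "\<And>y. mult v y = scale (g y) v"
  | (jordan) u v f g where "indep_pair u v"
      "\<And>y. mult u y = scale (f y) u + scale (g y) v" "\<And>y. mult v y = scale (f y) v"
proof (cases "\<exists>a u. indep_pair u (mult u a)")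
  case True
  then obtain a u where cyc: "indep_pair u (mult u a)" by blast
  define T where "T x = mult x a" for x
  note T_linear = mult_add_left[of _ _ a, folded T_def] mult_diff_left[of _ _ a, folded T_def]
    mult_scale_left[of _ _ a, folded T_def]
  have "indep_pair u (T u)" using cyc by (simp add: T_def)
  obtain d t where TTu: "T (T u) = scale d u + scale t (T u)"
    using indep_pair_spans[OF \<open>indep_pair u (T u)\<close>] .
  have "\<exists>p q. \<forall>x. mult x y = scale p x + scale q (T x)" for y
  proof -
    obtain p q where pq: "mult u y = scale p u + scale q (T u)"
      using indep_pair_spans[OF \<open>indep_pair u (T u)\<close>] .
    have "mult (T u) y = T (mult u y)"
      unfolding T_def by (rule right_commutative)
    also have "\<dots> = scale p (T u) + scale q (T (T u))"
      by (simp add: pq T_linear)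
    finally have Tu: "mult (T u) y = scale p (T u) + scale q (T (T u))" .
    have "mult x y = scale p x + scale q (T x)" for x
    proof -
      obtain b c where "x = scale b u + scale c (T u)"
        using indep_pair_spans[OF \<open>indep_pair u (T u)\<close>] .
      then show ?thesis
        by (simp add: mult_bilinear T_linear pq Tu algebra_simps)
    qed
    then show ?thesis by blast
  qed
  then obtain p q where pq: "\<And>x y. mult x y = scale (p y) x + scale (q y) (T x)"
    by metis
  \<comment> \<open>The eigenvalues of \<open>T\<close>: the roots of its characteristic polynomial \<open>X\<^sup>2 - t X - d\<close>.\<close>
  define \<kappa> where "\<kappa> = (t + csqrt (t\<^sup>2 + 4 * d)) / 2"
  define \<mu> where "\<mu> = (t - csqrt (t\<^sup>2 + 4 * d)) / 2"
  have t: "t = \<kappa> + \<mu>" by (simp add: \<kappa>_def \<mu>_def field_simps)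
  have "\<kappa> * \<mu> = (t\<^sup>2 - (csqrt (t\<^sup>2 + 4 * d))\<^sup>2) / 4"
    by (simp add: \<kappa>_def \<mu>_def field_simps power2_eq_square)
  then have d: "d = - \<kappa> * \<mu>" by simp
  \<comment> \<open>Cayley-Hamilton: \<open>(T - l) (T - m) u = 0\<close>.\<close>
  have T_eigen: "T (scale (- m) u + scale 1 (T u)) = scale l (scale (- m) u + scale 1 (T u))"
    if "t = l + m" "d = - l * m" for l m
    by (simp add: T_linear TTu that algebra_simps)
  show thesis
  proof (cases "\<kappa> = \<mu>")
    case True
    define v where "v = scale (- \<kappa>) u + scale 1 (T u)"
    have Tu: "T u = scale \<kappa> u + v" by (simp add: v_def)
    have Tv: "T v = scale \<kappa> v" unfolding v_def by (rule T_eigen) (use t d True in auto)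
    have "indep_pair u v"
      using indep_pair_change_of_basis[OF \<open>indep_pair u (T u)\<close>, of 1 1 0 "- \<kappa>"]
      by (simp add: v_def)
    then show thesis
    proof (rule jordan)
      show "mult u y = scale (p y + q y * \<kappa>) u + scale (q y) v" for y
        unfolding pq[of u y] Tu by (simp add: algebra_simps)
      show "mult v y = scale (p y + q y * \<kappa>) v" for y
        unfolding pq[of v y] Tv by (simp add: algebra_simps)
    qed
  next
    case False
    define v where "v = scale (- \<mu>) u + scale 1 (T u)"
    define w where "w = scale (- \<kappa>) u + scale 1 (T u)"
    have Tv: "T v = scale \<kappa> v" unfolding v_def by (rule T_eigen) (use t d in auto)
    have Tw: "T w = scale \<mu> w" unfolding w_def by (rule T_eigen) (use t d in auto)
    have "indep_pair v w"
      unfolding v_def w_def using False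
      by (intro indep_pair_change_of_basis[OF \<open>indep_pair u (T u)\<close>]) simp
    then show thesis
    proof (rule diagonal)
      show "mult v y = scale (p y + q y * \<kappa>) v" for y
        unfolding pq[of v y] Tv by (simp add: algebra_simps)
      show "mult w y = scale (p y + q y * \<mu>) w" for y
        unfolding pq[of w y] Tw by (simp add: algebra_simps)
    qed
  qed
next
  case False
  have eigen: "\<exists>c. mult x y = scale c x" if "x \<noteq> 0" for x y
  proof -
    have "\<not> indep_pair x (mult x y)" using False by blast
    then obtain a b where ab: "scale a x + scale b (mult x y) = 0" "a \<noteq> 0 \<or> b \<noteq> 0"
      by (auto simp: indep_pair_def)
    have "b \<noteq> 0" using ab that by auto
    have "scale b (mult x y) = scale (- a) x"
      using ab(1) by (simp add: eq_neg_iff_add_eq_0 add.commute)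
    then have "scale (inverse b) (scale b (mult x y)) = scale (inverse b) (scale (- a) x)"
      by simp
    then have "mult x y = scale (- (inverse b * a)) x" using \<open>b \<noteq> 0\<close> by simp
    then show ?thesis by blast
  qed
  obtain u v where uv: "indep_pair u v"
    using obtain_indep_pair .
  then have "u \<noteq> 0" "v \<noteq> 0"
    using indep_pairD(1)[of u v 1 0] indep_pairD(2)[of u v 0 1] by auto
  then obtain f g where "\<And>y. mult u y = scale (f y) u" "\<And>y. mult v y = scale (g y) v"
    using eigen by metis
  with uv show thesis by (rule diagonal)
qed

section \<open>The diagonal case\<close>

lemma diagonal_structure_equations:
  assumes uv: "indep_pair u v"
    and u: "mult u u = scale p u" "mult u v = scale q u"
    and v: "mult v u = scale r v" "mult v v = scale s v"
  shows "q * (\<delta> * p - r) = 0" "q * (\<delta> * q - s) = 0"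
    "r * (\<delta> * r - p) = 0" "r * (\<delta> * s - q) = 0"
proof -
  have "scale (\<delta> * q * p - r * q) u + scale 0 v = scale 0 u + scale (\<delta> * r * r - p * r) v"
    using delta_left_symmetric[of u v u] by (simp add: u v mult_bilinear algebra_simps)
  moreover have "scale (\<delta> * q * q - s * q) u + scale 0 v = scale 0 u + scale (\<delta> * r * s - q * r) v"
    using delta_left_symmetric[of u v v] by (simp add: u v mult_bilinear algebra_simps)
  ultimately show "q * (\<delta> * p - r) = 0" "q * (\<delta> * q - s) = 0"
    "r * (\<delta> * r - p) = 0" "r * (\<delta> * s - q) = 0"
    unfolding indep_pair_combination_eq_iff[OF uv] by (auto simp: algebra_simps)
qed

text \<open>
  For \<open>q \<noteq> 0\<close> the equations give \<open>(r, s) = \<delta> (p, q)\<close>: the eigenvalue functional of \<open>v\<close> is \<open>\<delta>\<close> times that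
  of \<open>u\<close>. If also \<open>r \<noteq> 0\<close>, the same holds with \<open>u\<close> and \<open>v\<close> exchanged, which forces
  \<open>\<delta>\<^sup>2 = 1\<close>.
\<close>

lemma diagonal_nonorthogonal_is_listed:
  assumes uv: "indep_pair u v"
    and u: "mult u u = scale p u" "mult u v = scale q u"
    and v: "mult v u = scale r v" "mult v v = scale s v"
    and q: "q \<noteq> 0"
  shows "\<exists>M. listed \<delta> M \<and> isomorphic_to M"
proof -
  have r: "r = \<delta> * p" and s: "s = \<delta> * q"
    using diagonal_structure_equations[OF uv u v] q by auto
  show ?thesis
  proof (cases "r = 0")
    case True
    show ?thesis
    proof (cases "\<delta> = 0")
      case True
      show ?thesis
      proof (cases "p = 0")
        case True
        have basis: "indep_pair (scale 1 u + scale 0 v) (scale 0 u + scale (1 / q) v)"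
          by (rule indep_pair_change_of_basis[OF uv]) (use q in simp)
        have "isomorphic_to N03"
          unfolding N03_def using q
          by (intro isomorphic_to_table_mult[OF basis])
            (simp_all add: axis_def mult_bilinear u v True r s \<open>\<delta> = 0\<close>)
        then show ?thesis using listed.intros(3) \<open>\<delta> = 0\<close> by blast
      next
        case False
        have basis: "indep_pair (scale (1 / p) u + scale 0 v) (scale 0 u + scale (1 / q) v)"
          by (rule indep_pair_change_of_basis[OF uv]) (use q False in simp)
        have "isomorphic_to N05"
          unfolding N05_def using q False
          by (intro isomorphic_to_table_mult[OF basis])
            (simp_all add: axis_def mult_bilinear u v r s \<open>\<delta> = 0\<close>)
        then show ?thesis using listed.intros(5) \<open>\<delta> = 0\<close> by blast
      qed
    next
      case False
      then have "p = 0" using True r by simp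
      have basis: "indep_pair (scale 0 u + scale (1 / s) v) (scale 1 u + scale 0 v)"
        by (rule indep_pair_change_of_basis[OF uv]) (use q s False in simp)
      have "isomorphic_to (N08 \<delta>)"
        unfolding N08_def using q False
        by (intro isomorphic_to_table_mult[OF basis])
          (simp_all add: axis_def mult_bilinear u v r s \<open>p = 0\<close> field_simps)
      then show ?thesis using listed.intros(8) False by blast
    qed
  next
    case False
    then have q': "q = \<delta> * s"
      using diagonal_structure_equations[OF uv u v] by auto
    have "p \<noteq> 0" using False r by auto
    have "\<delta>\<^sup>2 * q = q" using q' s by (simp add: power2_eq_square mult.assoc)
    then have "\<delta> = 1 \<or> \<delta> = - 1" using q by (simp add: power2_eq_1_iff)
    then show ?thesis
    proof
      assume \<delta>: "\<delta> = 1"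
      \<comment> \<open>Now \<open>xy = f(y) x\<close> for a functional \<open>f\<close>; take a vector with \<open>f = 1\<close> and one in the kernel.\<close>
      have basis: "indep_pair (scale 0 u + scale (1 / q) v) (scale q u + scale (- p) v)"
        by (rule indep_pair_change_of_basis[OF uv]) (use q in simp)
      have "isomorphic_to (N08 \<delta>)"
        unfolding N08_def using q
        by (intro isomorphic_to_table_mult[OF basis])
          (simp_all add: axis_def mult_bilinear u v r s \<delta> field_simps)
      then show ?thesis using listed.intros(8)[of \<delta>] \<delta> by auto
    next
      assume \<delta>: "\<delta> = - 1"
      have basis: "indep_pair (scale (1 / p) u + scale 0 v) (scale 0 u + scale (- 1 / q) v)"
        by (rule indep_pair_change_of_basis[OF uv]) (use q \<open>p \<noteq> 0\<close> in simp)
      have "isomorphic_to N12"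
        unfolding N12_def using q \<open>p \<noteq> 0\<close>
        by (intro isomorphic_to_table_mult[OF basis])
          (simp_all add: axis_def mult_bilinear u v r s \<delta> field_simps)
      then show ?thesis using listed.intros(12)[of \<delta>] \<delta> by auto
    qed
  qed
qed

lemma diagonal_is_listed:
  assumes uv: "indep_pair u v"
    and u: "mult u u = scale p u" "mult u v = scale q u"
    and v: "mult v u = scale r v" "mult v v = scale s v"
    and nontrivial: "mult a b \<noteq> 0"
  shows "\<exists>M. listed \<delta> M \<and> isomorphic_to M"
proof -
  have N07: "isomorphic_to N07"
    if "indep_pair x y" "mult x x = scale c x" "c \<noteq> 0" "mult x y = 0" "mult y x = 0" "mult y y = 0"
    for x y c
  proof -
    have basis: "indep_pair (scale (1 / c) x + scale 0 y) (scale 0 x + scale 1 y)"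
      by (rule indep_pair_change_of_basis[OF that(1)]) (use that in simp)
    show ?thesis
      unfolding N07_def using that
      by (intro isomorphic_to_table_mult[OF basis])
        (simp_all add: axis_def mult_bilinear)
  qed
  consider "q \<noteq> 0" | "r \<noteq> 0" | "q = 0" "r = 0" "p = 0" "s = 0"
    | "q = 0" "r = 0" "p = 0" "s \<noteq> 0" | "q = 0" "r = 0" "p \<noteq> 0" "s = 0"
    | "q = 0" "r = 0" "p \<noteq> 0" "s \<noteq> 0"
    by blast
  then show ?thesis
  proof cases
    case 1
    with uv u v show ?thesis by (rule diagonal_nonorthogonal_is_listed)
  next
    case 2
    with indep_pair_swap[OF uv] v(2,1) u(2,1) show ?thesis
      by (rule diagonal_nonorthogonal_is_listed)
  next
    case 3
    obtain a1 a2 b1 b2 where "a = scale a1 u + scale a2 v" "b = scale b1 u + scale b2 v"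
      using indep_pair_spans[OF uv] by metis
    with nontrivial 3 u v show ?thesis by (simp add: mult_bilinear)
  next
    case 4
    with N07[OF indep_pair_swap[OF uv] v(2)] u v have "isomorphic_to N07" by simp
    then show ?thesis using listed.intros(7) by blast
  next
    case 5
    with N07[OF uv u(1)] u v have "isomorphic_to N07" by simp
    then show ?thesis using listed.intros(7) by blast
  next
    case 6
    have basis: "indep_pair (scale (1 / p) u + scale 0 v) (scale 0 u + scale (1 / s) v)"
      by (rule indep_pair_change_of_basis[OF uv]) (use 6 in simp)
    have "isomorphic_to N11"
      unfolding N11_def using 6
      by (intro isomorphic_to_table_mult[OF basis])
        (simp_all add: axis_def mult_bilinear u v)
    then show ?thesis using listed.intros(11) by blast
  qed
qed

section \<open>The Jordan case\<close>

text \<open>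
  If \<open>q \<noteq> 0\<close>, the coefficients of \<open>u\<close> force \<open>\<delta> = 1\<close>, and then those of \<open>v\<close> give
  \<open>2 q r = 2 q s = 0\<close>, so the nilpotent part would vanish.
\<close>

lemma jordan_structure_equations:
  assumes uv: "indep_pair u v"
    and u: "mult u u = scale p u + scale r v" "mult u v = scale q u + scale s v"
    and v: "mult v u = scale p v" "mult v v = scale q v"
    and rs: "r \<noteq> 0 \<or> s \<noteq> 0"
  shows "q = 0" "(\<delta> - 1) * (s - p) * p = 0"
proof -
  have "scale (\<delta> * q * p - p * q) u + scale (\<delta> * q * r + \<delta> * s * p - p * s) v
      = scale 0 u + scale (\<delta> * p * p - p * p - r * q) v"
    using delta_left_symmetric[of u v u] by (simp add: u v mult_bilinear algebra_simps)
  then have 1: "\<delta> * q * p - p * q = 0"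
      "\<delta> * q * r + \<delta> * s * p - p * s = \<delta> * p * p - p * p - r * q"
    unfolding indep_pair_combination_eq_iff[OF uv] by simp_all
  have "scale (\<delta> * q * q - q * q) u + scale (\<delta> * q * s - q * s) v
      = scale 0 u + scale (\<delta> * p * q - q * p - s * q - \<delta> * s * q) v"
    using delta_left_symmetric[of u v v] by (simp add: u v mult_bilinear algebra_simps)
  then have 2: "\<delta> * q * q - q * q = 0"
      "\<delta> * q * s - q * s = \<delta> * p * q - q * p - s * q - \<delta> * s * q"
    unfolding indep_pair_combination_eq_iff[OF uv] by simp_all
  show q: "q = 0"
  proof (rule ccontr)
    assume "q \<noteq> 0"
    have "(\<delta> - 1) * q * q = 0" using 2(1) by (simp add: algebra_simps)
    with \<open>q \<noteq> 0\<close> have "\<delta> = 1" by simp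
    with 1(2) 2(2) have "q * r + r * q = 0" "q * s + s * q = 0" by (simp_all add: algebra_simps)
    with \<open>q \<noteq> 0\<close> rs show False by (simp add: mult.commute flip: mult_2)
  qed
  show "(\<delta> - 1) * (s - p) * p = 0"
    using 1(2) q by (simp add: algebra_simps)
qed

lemma jordan_is_listed:
  assumes uv: "indep_pair u v"
    and u: "mult u u = scale p u + scale r v" "mult u v = scale q u + scale s v"
    and v: "mult v u = scale p v" "mult v v = scale q v"
    and nontrivial: "mult a b \<noteq> 0"
  shows "\<exists>M. listed \<delta> M \<and> isomorphic_to M"
proof (cases "r = 0 \<and> s = 0")
  case True
  then have "mult u u = scale p u" "mult u v = scale q u" using u by simp_all
  with uv show ?thesis using v nontrivial by (rule diagonal_is_listed)
next
  case False
  then have q: "q = 0" and \<delta>: "(\<delta> - 1) * (s - p) * p = 0"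
    using jordan_structure_equations[OF uv u v] by auto
  note products = u v q mult_bilinear
  consider "p = 0" "s = 0" | "p = 0" "s \<noteq> 0" | "p \<noteq> 0" "s = 0" | "p \<noteq> 0" "s \<noteq> 0"
    by blast
  then show ?thesis
  proof cases
    case 1
    have basis: "indep_pair (scale 1 u + scale 0 v) (scale 0 u + scale r v)"
      by (rule indep_pair_change_of_basis[OF uv]) (use 1 False in simp)
    have "isomorphic_to N02"
      unfolding N02_def
      by (intro isomorphic_to_table_mult[OF basis])
        (simp_all add: axis_def products 1)
    then show ?thesis using listed.intros(2) by blast
  next
    case 2
    \<comment> \<open>The coefficient of \<open>v\<close> in the second vector makes its square vanish.\<close>
    have basis: "indep_pair (scale 0 u + scale 1 v) (scale (1 / s) u + scale (- r / s\<^sup>2) v)"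
      by (rule indep_pair_change_of_basis[OF uv]) (use 2 in simp)
    have "isomorphic_to N04"
      unfolding N04_def using 2
      by (intro isomorphic_to_table_mult[OF basis])
        (simp_all add: axis_def products field_simps power2_eq_square)
    then show ?thesis using listed.intros(4) by blast
  next
    case 3
    have basis: "indep_pair (scale (1 / p) u + scale 0 v) (scale 0 u + scale (r / p\<^sup>2) v)"
      by (rule indep_pair_change_of_basis[OF uv]) (use 3 False in simp)
    have "isomorphic_to N01"
      unfolding N01_def using 3
      by (intro isomorphic_to_table_mult[OF basis])
        (simp_all add: axis_def products field_simps power2_eq_square)
    then show ?thesis using listed.intros(1) \<delta> 3 by auto
  next
    case 4
    \<comment> \<open>The coefficient of \<open>v\<close> in the first vector makes it idempotent.\<close>
    have basis: "indep_pair (scale (1 / p) u + scale (- r / (p * s)) v) (scale 0 u + scale 1 v)"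
      by (rule indep_pair_change_of_basis[OF uv]) (use 4 in simp)
    have "isomorphic_to (table_mult e1 ((s / p) *s e2) e2 0)"
      using 4
      by (intro isomorphic_to_table_mult[OF basis])
        (simp_all add: axis_def products field_simps)
    then have N10: "isomorphic_to (N10 (s / p))" by (simp add: N10_def)
    show ?thesis
    proof (cases "s = p")
      case True
      then have "isomorphic_to N09" using N10 4 by (simp add: N09_def N10_def)
      then show ?thesis using listed.intros(9) by blast
    next
      case False
      then have "\<delta> = 1" "s / p \<noteq> 1" using \<delta> 4 by auto
      then show ?thesis using N10 listed.intros(10) by blast
    qed
  qed
qed

lemma nontrivial_is_listed:
  assumes "mult a b \<noteq> 0"
  shows "\<exists>M. listed \<delta> M \<and> isomorphic_to M"
proof (cases rule: right_multiplications_normal_form)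
  case (diagonal u v f g)
  show ?thesis
    by (rule diagonal_is_listed[OF diagonal(1)]) (fact diagonal assms)+
next
  case (jordan u v f g)
  show ?thesis
    by (rule jordan_is_listed[OF jordan(1)]) (fact jordan assms)+
qed

end

section \<open>The listed algebras\<close>

lemma complex_algebra_table_mult: "complex_algebra (*s) (table_mult p11 p12 p21 p22)"
  by unfold_locales (auto simp: vec_eq_iff table_mult_def algebra_simps)

lemma listed_imp_novikov_algebra:
  assumes "listed \<delta> M"
  shows "novikov_algebra (*s) M \<delta>"
proof -
  obtain p11 p12 p21 p22 where M: "M = table_mult p11 p12 p21 p22"
    using assms by cases
      (auto simp: N01_def N02_def N03_def N04_def N05_def N06_def N07_def N08_def N09_def N10_def
        N11_def N12_def)
  interpret complex_algebra "(*s)" M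
    unfolding M by (rule complex_algebra_table_mult)
  have cancel: "\<delta> * (inverse \<delta> * w) = w" if "\<delta> \<noteq> 0" for w
    using that by simp
  show ?thesis
  proof
    fix x y z
    show "\<delta> *s M (M x y) z - M x (M y z) = \<delta> *s M (M y x) z - M y (M x z)"
      using assms by cases
        (simp_all add: N01_def N02_def N03_def N04_def N05_def N06_def N07_def N08_def N09_def
          N10_def N11_def N12_def vec_eq_iff forall_2 axis_def table_mult_def cancel
          algebra_simps)
    show "M (M x y) z = M (M x z) y"
      using assms by cases
        (simp_all add: N01_def N02_def N03_def N04_def N05_def N06_def N07_def N08_def N09_def
          N10_def N11_def N12_def vec_eq_iff forall_2 axis_def table_mult_def algebra_simps)
  qed
qed

theorem theorem11:
  fixes \<delta> :: complex
  shows "(\<forall>(scale :: complex \<Rightarrow> 'a::ab_group_add \<Rightarrow> 'a) mult.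
            novikov_algebra scale mult \<delta> \<and>
            vector_space.dim scale (UNIV :: 'a set) = 2 \<and>
            (\<exists>x y. mult x y \<noteq> 0) \<longrightarrow>
            (\<exists>M. listed \<delta> M \<and>
                 algebra_isomorphic scale mult ((*s) :: complex \<Rightarrow> complex ^ 2 \<Rightarrow> complex ^ 2) M)) \<and>
         (\<forall>M. listed \<delta> M \<longrightarrow>
            novikov_algebra ((*s) :: complex \<Rightarrow> complex ^ 2 \<Rightarrow> complex ^ 2) M \<delta>)"
proof (intro conjI allI impI; (elim conjE exE)?)
  fix scale :: "complex \<Rightarrow> 'a \<Rightarrow> 'a" and mult x y
  assume "novikov_algebra scale mult \<delta>" and dim: "vector_space.dim scale (UNIV :: 'a set) = 2"
    and "mult x y \<noteq> 0"
  then interpret novikov_algebra scale mult \<delta> by simp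
  interpret plane_novikov_algebra scale mult \<delta>
    by unfold_locales (rule dim)
  show "\<exists>M. listed \<delta> M \<and> algebra_isomorphic scale mult (*s) M"
    using \<open>mult x y \<noteq> 0\<close> by (rule nontrivial_is_listed)
qed (rule listed_imp_novikov_algebra)

end
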